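(* Let $d\geq3$ and let $\Omega\subset\mathbb{R}^d$ be a bounded domain with $C^2$ boundary and outer unit normal $\nu$. Suppose that for some $c\in\mathbb{R}$ and some $\alpha>d$ there is $u\in C^2(\mathbb{R}^d\setminus\Omega)$ with $\Delta u=d$ in $\mathbb{R}^d\setminus\bar\Omega$, $u=0$ and $\partial u/\partial\nu=1$ on $\partial\Omega$, and $$\limsup_{|x|\to\infty}|x|^\alpha\Big|u(x)-\Big(\tfrac12|x|^2+c\Big)\Big|<\infty.$$ Then $\Omega$ is the unit ball centered at the origin and $u(x)=\frac12|x|^2-\frac12$. *)

theory Defs
  imports "HOL-Analysis.Analysis"
begin

text \<open>C^2 regularity of a real function on a (not necessarily open) set S:
  first and second derivatives exist relative to S and are continuous on S.
  For closed S this is "C^2 up to the boundary".\<close>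
definition C2_on :: "'a::euclidean_space set \<Rightarrow> ('a \<Rightarrow> real) \<Rightarrow> bool" where
  "C2_on S u \<longleftrightarrow>
     (\<exists>g H. (\<forall>x\<in>S. (u has_derivative (\<lambda>h. g x \<bullet> h)) (at x within S))
          \<and> continuous_on S g
          \<and> (\<forall>x\<in>S. (g has_derivative H x) (at x within S))
          \<and> (\<forall>h. continuous_on S (\<lambda>x. H x h)))"

definition grad :: "('a::euclidean_space \<Rightarrow> real) \<Rightarrow> 'a \<Rightarrow> 'a" where
  "grad f x = (\<Sum>b\<in>Basis. frechet_derivative f (at x) b *\<^sub>R b)"

definition laplacian :: "('a::euclidean_space \<Rightarrow> real) \<Rightarrow> 'a \<Rightarrow> real" where
  "laplacian f x =
     (\<Sum>b\<in>Basis. frechet_derivative (\<lambda>y. frechet_derivative f (at y) b) (at x) b)"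

definition local_defining_fun ::
  "'a::euclidean_space set \<Rightarrow> 'a \<Rightarrow> 'a set \<Rightarrow> ('a \<Rightarrow> real) \<Rightarrow> bool" where
  "local_defining_fun \<Omega> p U \<rho> \<longleftrightarrow>
     open U \<and> p \<in> U \<and> C2_on U \<rho> \<and> (\<forall>x\<in>U. grad \<rho> x \<noteq> 0)
     \<and> \<Omega> \<inter> U = {x\<in>U. \<rho> x < 0}"

definition C2_boundary :: "'a::euclidean_space set \<Rightarrow> bool" where
  "C2_boundary \<Omega> \<longleftrightarrow> (\<forall>p\<in>frontier \<Omega>. \<exists>U \<rho>. local_defining_fun \<Omega> p U \<rho>)"

text \<open>Outer unit normal at a boundary point (independent of the chosen defining function).\<close>
definition outer_normal :: "'a::euclidean_space set \<Rightarrow> 'a \<Rightarrow> 'a" where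
  "outer_normal \<Omega> p =
     (let \<rho> = (SOME \<rho>. \<exists>U. local_defining_fun \<Omega> p U \<rho>)
      in grad \<rho> p /\<^sub>R norm (grad \<rho> p))"

end

theory Submission
  imports Defs
begin

text \<open>The function \<open>w x = u x - (norm x ^ 2 / 2 + c)\<close> is harmonic outside \<open>\<Omega>\<close> and decays faster
  than the strictly subharmonic barrier \<open>norm (x - x0) powr - d\<close> with \<open>x0 \<in> \<Omega>\<close>. Comparison with
  this barrier shows that the supremum of \<open>w\<close> is nonnegative and its infimum nonpositive, and that
  both are attained on the boundary, where \<open>w x = - (norm x ^ 2 / 2 + c)\<close>. So \<open>w\<close> is minimal at a
  boundary point \<open>p\<close> of largest norm and maximal at a boundary point \<open>q\<close> of smallest norm. The
  normal derivative of \<open>w\<close> is \<open>1 - x \<bullet> \<nu>\<close>. At \<open>p\<close> it is nonnegative and \<open>p \<bullet> \<nu> = norm p\<close>, hence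
  \<open>norm p \<le> 1\<close>; at \<open>q\<close> it is nonpositive, hence \<open>norm q \<ge> q \<bullet> \<nu> \<ge> 1\<close>. Thus the boundary lies in
  the unit sphere, where \<open>w\<close> is constant, and therefore \<open>w = 0\<close>.\<close>

section \<open>Second-order test at a maximum and derivatives of radial powers\<close>

text \<open>On the line through \<open>z\<close> in direction \<open>v\<close>, the first derivative
  \<open>\<psi>\<close> vanishes at 0. Were its slope \<open>H v \<bullet> v\<close> positive,
  \<open>\<psi>\<close> would be positive just to the right of 0 and \<open>f\<close> would climb
  above \<open>f z\<close>.\<close>

lemma second_derivative_local_max:
  fixes f :: "'a::euclidean_space \<Rightarrow> real"
  assumes S: "open S" "z \<in> S"
    and f': "\<And>x. x \<in> S \<Longrightarrow> (f has_derivative (\<lambda>h. G x \<bullet> h)) (at x)"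
    and G': "(G has_derivative H) (at z)"
    and max: "\<And>x. x \<in> S \<Longrightarrow> f x \<le> f z"
  shows "H v \<bullet> v \<le> 0"
proof (rule ccontr)
  assume "\<not> H v \<bullet> v \<le> 0"
  then have pos: "H v \<bullet> v > 0" by simp
  have cont: "isCont (\<lambda>t. z + t *\<^sub>R v) 0" by simp
  have "\<forall>\<^sub>F t in at 0. z + t *\<^sub>R v \<in> S"
    using S cont[unfolded isCont_def]
    by (intro topological_tendstoD) auto
  then obtain e where e: "e > 0" and e': "\<And>t. t \<noteq> 0 \<Longrightarrow> \<bar>t\<bar> < e \<Longrightarrow> z + t *\<^sub>R v \<in> S"
    unfolding eventually_at dist_real_def by auto
  have in_S: "z + t *\<^sub>R v \<in> S" if "\<bar>t\<bar> < e" for t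
    using e'[of t] that S(2) by (cases "t = 0") auto
  define \<phi> where "\<phi> t = f (z + t *\<^sub>R v)" for t
  define \<psi> where "\<psi> t = G (z + t *\<^sub>R v) \<bullet> v" for t
  have line: "((\<lambda>t. z + t *\<^sub>R v) has_derivative (\<lambda>t. t *\<^sub>R v)) (at t)" for t
    by (auto intro!: derivative_eq_intros)
  have d1: "(\<phi> has_real_derivative \<psi> t) (at t)" if "\<bar>t\<bar> < e" for t
    using has_derivative_compose[OF line f'[OF in_S[OF that]]]
    unfolding \<phi>_def \<psi>_def has_field_derivative_def by (simp add: mult_commute_abs)
  have "bounded_linear H" using G' by (rule has_derivative_bounded_linear)
  then interpret bounded_linear H .
  have "((\<lambda>t. G (z + t *\<^sub>R v)) has_derivative (\<lambda>t. H (t *\<^sub>R v))) (at 0)"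
    using has_derivative_compose[OF line[of 0], of G H] G' by simp
  then have "(\<psi> has_derivative (\<lambda>t. H (t *\<^sub>R v) \<bullet> v)) (at 0)"
    unfolding \<psi>_def by (rule has_derivative_inner_left)
  then have d2: "(\<psi> has_real_derivative H v \<bullet> v) (at 0)"
    unfolding has_field_derivative_def by (simp add: scaleR mult_commute_abs)
  have "\<psi> 0 = 0"
    using DERIV_local_max[OF d1[of 0] e] e max in_S by (auto simp: \<phi>_def)
  then obtain d where d: "d > 0" "\<And>h. 0 < h \<Longrightarrow> h < d \<Longrightarrow> \<psi> h > 0"
    using DERIV_pos_inc_right[OF d2 pos] by auto
  define t where "t = min d e / 2"
  have t: "t > 0" "t < d" "t < e" using d e by (auto simp: t_def)
  have "\<phi> 0 < \<phi> t"
  proof (rule DERIV_pos_imp_increasing_open[OF t(1)])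
    show "\<exists>y. (\<phi> has_real_derivative y) (at x) \<and> y > 0" if "0 < x" "x < t" for x
      using d1[of x] d(2)[of x] that t by (intro exI[of _ "\<psi> x"]) auto
    show "continuous_on {0..t} \<phi>"
      using d1 t by (intro DERIV_continuous_on[where D = \<psi>] DERIV_subset[OF d1]) auto
  qed
  moreover have "\<phi> t \<le> \<phi> 0"
    using max[OF in_S[of t]] t by (simp add: \<phi>_def)
  ultimately show False by simp
qed

text \<open>The squared norm is an inner product, so no square root has to be differentiated;
  \<open>p\<close> is therefore half the exponent of the distance.\<close>

lemma has_derivative_dist_powr:
  fixes a x :: "'a::euclidean_space"
  assumes "x \<noteq> a"
  shows "((\<lambda>x. (norm (x - a))\<^sup>2 powr p) has_derivative
     (\<lambda>h. ((2 * p * (norm (x - a))\<^sup>2 powr (p - 1)) *\<^sub>R (x - a)) \<bullet> h)) (at x)"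
proof -
  have pos: "(norm (x - a))\<^sup>2 > 0" using assms by simp
  have "((\<lambda>x. (norm (x - a))\<^sup>2) has_derivative (\<lambda>h. 2 * ((x - a) \<bullet> h))) (at x)"
    unfolding power2_norm_eq_inner
    by (auto intro!: derivative_eq_intros simp: inner_commute)
  from DERIV_compose_FDERIV[OF has_real_derivative_powr[OF pos] this]
  show ?thesis by (simp add: mult_ac)
qed

lemma has_derivative_grad_dist_powr:
  fixes a x :: "'a::euclidean_space"
  assumes "x \<noteq> a"
  shows "((\<lambda>x. ((norm (x - a))\<^sup>2 powr p) *\<^sub>R (x - a)) has_derivative
     (\<lambda>h. ((norm (x - a))\<^sup>2 powr p) *\<^sub>R h
        + (2 * p * (norm (x - a))\<^sup>2 powr (p - 1) * ((x - a) \<bullet> h)) *\<^sub>R (x - a))) (at x)"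
proof -
  have "((\<lambda>x. x - a) has_derivative (\<lambda>h. h)) (at x)"
    by (auto intro!: derivative_eq_intros)
  from has_derivative_scaleR[OF has_derivative_dist_powr[OF assms, of p] this]
  show ?thesis by simp
qed

section \<open>Maximum principle in an exterior domain\<close>

text \<open>The locale serves for a function and for its negative alike. \<open>G\<close> and
  \<open>H\<close> are gradient and Hessian given as data, so subharmonicity is a sign of the
  trace.\<close>

locale exterior_subharmonic =
  fixes \<Omega> :: "'a::euclidean_space set" and f :: "'a \<Rightarrow> real"
    and G :: "'a \<Rightarrow> 'a" and H :: "'a \<Rightarrow> 'a \<Rightarrow> 'a" and \<alpha> M :: real
  assumes dom: "open \<Omega>" "bounded \<Omega>" "\<Omega> \<noteq> {}"
    and cont: "continuous_on (- \<Omega>) f"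
    and f': "\<And>x. x \<in> - closure \<Omega> \<Longrightarrow> (f has_derivative (\<lambda>h. G x \<bullet> h)) (at x)"
    and G': "\<And>x. x \<in> - closure \<Omega> \<Longrightarrow> (G has_derivative H x) (at x)"
    and subharmonic: "\<And>x. x \<in> - closure \<Omega> \<Longrightarrow> (\<Sum>b\<in>Basis. H x b \<bullet> b) \<ge> 0"
    and decay: "\<forall>\<^sub>F x in at_infinity. norm x powr \<alpha> * \<bar>f x\<bar> \<le> M"
    and exponent: "\<alpha> > real DIM('a)"
begin

lemma tendsto_zero: "(f \<longlongrightarrow> 0) at_infinity"
proof (rule Lim_null_comparison)
  show "\<forall>\<^sub>F x in at_infinity. norm (f x) \<le> M * norm x powr (- \<alpha>)"
    using decay eventually_not_equal_at_infinity[of 0]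
    by eventually_elim (auto simp: powr_minus field_simps)
  have "((\<lambda>x::'a. norm x powr (- \<alpha>)) \<longlongrightarrow> 0) at_infinity"
    using exponent by (intro tendsto_neg_powr filterlim_norm_at_top) auto
  then show "((\<lambda>x::'a. M * norm x powr (- \<alpha>)) \<longlongrightarrow> 0) at_infinity"
    by (rule tendsto_mult_right_zero)
qed

text \<open>With r the distance to \<open>a\<close> and d the dimension, this is r^(-d). As r^s has
  Laplacian s (s + d - 2) r^(s - 2), the choice s = -d gives 2 d r^(-d - 2) > 0.\<close>

abbreviation barrier :: "'a \<Rightarrow> 'a \<Rightarrow> real" where
  "barrier a x \<equiv> (norm (x - a))\<^sup>2 powr (- real DIM('a) / 2)"

lemma barrier_tendsto_zero: "((\<lambda>x. barrier a x) \<longlongrightarrow> 0) at_infinity"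
proof -
  have "filterlim (\<lambda>x. - a + x) at_infinity at_infinity"
    by (rule tendsto_add_filterlim_at_infinity[OF tendsto_const filterlim_ident])
  then have "filterlim (\<lambda>x. norm (x - a)) at_top at_infinity"
    using filterlim_at_infinity_imp_norm_at_top by fastforce
  then show ?thesis
    by (intro tendsto_neg_powr filterlim_pow_at_top) auto
qed

text \<open>A value above \<open>m\<close> lies above the limit 0 at infinity, so the sum would
  attain its maximum over the exterior off the frontier. There the trace of its Hessian is
  nonpositive, yet the barrier makes it strictly positive.\<close>

lemma barrier_comparison:
  assumes a: "a \<in> \<Omega>" and e: "e > 0" and m: "m \<ge> 0"
    and bd: "\<And>x. x \<in> frontier \<Omega> \<Longrightarrow> f x + e * barrier a x \<le> m"
    and y: "y \<in> - \<Omega>"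
  shows "f y + e * barrier a y \<le> m"
proof (rule ccontr)
  let ?F = "\<lambda>x. f x + e * barrier a x"
  let ?d = "real DIM('a)"
  assume "\<not> ?thesis"
  then have y': "?F y > m" by simp
  have "(?F \<longlongrightarrow> 0 + e * 0) at_infinity"
    by (intro tendsto_intros tendsto_zero barrier_tendsto_zero)
  then have "\<forall>\<^sub>F x in at_infinity. ?F x < ?F y"
    using y' m by (intro order_tendstoD(2)[of _ 0]) auto
  then obtain R where R: "\<And>x. R \<le> norm x \<Longrightarrow> ?F x < ?F y"
    unfolding eventually_at_infinity by blast
  have "norm y < R" using R[of y] by force
  define K where "K = cball 0 R - \<Omega>"
  have "compact K" unfolding K_def by (intro compact_diff dom compact_cball)
  moreover have "y \<in> K" using y \<open>norm y < R\<close> by (auto simp: K_def)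
  moreover have "continuous_on K ?F"
  proof (rule continuous_on_subset)
    show "continuous_on (- \<Omega>) ?F"
      using a by (intro continuous_intros cont) auto
  qed (auto simp: K_def)
  ultimately obtain z where z: "z \<in> K" "\<And>x. x \<in> K \<Longrightarrow> ?F x \<le> ?F z"
    using continuous_attains_sup[of K ?F] by auto
  \<comment> \<open>Beyond radius \<open>R\<close> the sum stays below its value at
    \<open>y\<close>, a point of \<open>K\<close>, so the maximum over the compact set
    \<open>K\<close> is a maximum over the whole exterior.\<close>
  have zmax: "?F x \<le> ?F z" if "x \<in> - closure \<Omega>" for x
  proof (cases "norm x \<le> R")
    case True
    then show ?thesis using z(2)[of x] that closure_subset[of \<Omega>] by (auto simp: K_def)
  next
    case False
    then have "?F x < ?F y" by (intro R) simp
    then show ?thesis using z(2)[OF \<open>y \<in> K\<close>] by simp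
  qed
  have "z \<notin> frontier \<Omega>" using bd[of z] z(2)[OF \<open>y \<in> K\<close>] y' by auto
  then have zc: "z \<in> - closure \<Omega>"
    using z(1) dom(1) by (auto simp: K_def frontier_def interior_open)
  have ne: "x \<noteq> a" if "x \<in> - closure \<Omega>" for x
    using that a closure_subset[of \<Omega>] by auto
  \<comment> \<open>The exponent left after one differentiation: the barrier has gradient -d s^p (x
    - a) with s the squared distance.\<close>
  define p where "p = - ?d / 2 - 1"
  define G1 where "G1 x = G x + (e * - ?d) *\<^sub>R ((norm (x - a))\<^sup>2 powr p *\<^sub>R (x - a))" for x
  define H1 where "H1 x h = H x h + (e * - ?d) *\<^sub>R (((norm (x - a))\<^sup>2 powr p) *\<^sub>R h
        + (2 * p * (norm (x - a))\<^sup>2 powr (p - 1) * ((x - a) \<bullet> h)) *\<^sub>R (x - a))" for x h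
  have F': "(?F has_derivative (\<lambda>h. G1 x \<bullet> h)) (at x)" if "x \<in> - closure \<Omega>" for x
  proof -
    have "(?F has_derivative (\<lambda>h. G x \<bullet> h + e * 
       (((2 * (- ?d / 2) * (norm (x - a))\<^sup>2 powr (- ?d / 2 - 1)) *\<^sub>R (x - a)) \<bullet> h))) (at x)"
      by (intro has_derivative_add f' that has_derivative_mult_right has_derivative_dist_powr ne)
    then show ?thesis by (simp add: G1_def p_def inner_add_left algebra_simps)
  qed
  have G1': "(G1 has_derivative H1 z) (at z)"
    unfolding G1_def H1_def
    by (intro has_derivative_add G' zc has_derivative_scaleR_right has_derivative_grad_dist_powr ne)
  have "H1 z b \<bullet> b \<le> 0" for b
    by (rule second_derivative_local_max[OF _ zc F' G1' zmax]) auto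
  then have "(\<Sum>b\<in>Basis. H1 z b \<bullet> b) \<le> 0" by (intro sum_nonpos)
  moreover have "(\<Sum>b\<in>Basis. H1 z b \<bullet> b) > 0"
  proof -
    define s where "s = (norm (z - a))\<^sup>2"
    have s: "s > 0" using ne[OF zc] by (simp add: s_def)
    have sum_s: "(\<Sum>b\<in>Basis. ((z - a) \<bullet> b) * ((z - a) \<bullet> b)) = s"
      unfolding s_def power2_norm_eq_inner by (rule euclidean_inner[symmetric])
    have "(\<Sum>b\<in>Basis. H1 z b \<bullet> b) = (\<Sum>b\<in>Basis. H z b \<bullet> b) + 
       (\<Sum>b\<in>(Basis::'a set). (e * - ?d) * (s powr p) +
          (e * - ?d) * (2 * p * s powr (p - 1)) * (((z - a) \<bullet> b) * ((z - a) \<bullet> b)))"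
      unfolding sum.distrib[symmetric] H1_def s_def[symmetric]
      by (intro sum.cong refl) (simp add: inner_add_left algebra_simps)
    also have "\<dots> = (\<Sum>b\<in>Basis. H z b \<bullet> b) + 
       (?d * ((e * - ?d) * (s powr p)) + (e * - ?d) * (2 * p * s powr (p - 1)) * s)"
      unfolding sum.distrib sum_distrib_left[symmetric] sum_s by simp
    also have "s powr (p - 1) = s powr p / s" using s by (simp add: powr_diff)
    \<comment> \<open>Since 2 p = -d - 2, the sum is -e d (d + 2 p) s^p, and d + 2 p = -2.\<close>
    also have "?d * ((e * - ?d) * (s powr p)) + (e * - ?d) * (2 * p * (s powr p / s)) * s
      = 2 * e * ?d * s powr p"
      using s by (simp add: p_def field_simps)
    finally show ?thesis
      using subharmonic[OF zc] s e by (simp add: add_nonneg_pos)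
  qed
  ultimately show False by simp
qed

text \<open>The bound \<open>m \<ge> 0\<close> is a Hopf lemma at infinity.\<close>

theorem maximum_principle:
  assumes bd: "\<And>x. x \<in> frontier \<Omega> \<Longrightarrow> f x \<le> m"
  shows "m \<ge> 0" and "\<And>x. x \<in> - \<Omega> \<Longrightarrow> f x \<le> m"
proof -
  let ?d = "real DIM('a)"
  obtain a where a: "a \<in> \<Omega>" using dom by auto
  then obtain r where r: "r > 0" "ball a r \<subseteq> \<Omega>" using dom open_contains_ball by blast
  \<comment> \<open>The barrier at distance \<open>r\<close> from \<open>a\<close>; the frontier is
    at least that far away, so \<open>C\<close> bounds the barrier there.\<close>
  define C where "C = r\<^sup>2 powr (- ?d / 2)"
  have C: "C > 0" using r by (simp add: C_def)
  have far: "barrier a x \<le> C" if "x \<in> frontier \<Omega>" for x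
  proof -
    have "x \<notin> \<Omega>" using that dom(1) by (auto simp: frontier_def interior_open)
    then have "r \<le> norm (x - a)" using r by (force simp: dist_norm norm_minus_commute)
    then show ?thesis unfolding C_def using r
      by (intro powr_mono2' power_mono) auto
  qed
  show m: "m \<ge> 0"
  proof (rule ccontr)
    assume "\<not> m \<ge> 0"
    then have "m < 0" by simp
    \<comment> \<open>The largest multiple for which \<open>C\<close> guarantees that the barrier
      term on the frontier is at most \<open>- m\<close>. Comparison with bound 0 then forces
      \<open>f\<close> below a negative multiple of the barrier, hence to decay no faster than
      it.\<close>
    define e where "e = - m / C"
    have e: "e > 0" using \<open>m < 0\<close> C by (simp add: e_def divide_neg_pos)
    have bd0: "f x + e * barrier a x \<le> 0" if "x \<in> frontier \<Omega>" for x
    proof -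
      have "e * barrier a x \<le> e * C" using far[OF that] e by (intro mult_left_mono) auto
      also have "\<dots> = - m" using C by (simp add: e_def)
      finally show ?thesis using bd[OF that] by simp
    qed
    have below: "f x + e * barrier a x \<le> 0" if "x \<in> - \<Omega>" for x
      by (rule barrier_comparison[OF a e order_refl bd0 that])
    have "\<forall>\<^sub>F x::'a in at_infinity. e \<le> M * 2 powr ?d * norm x powr (- (\<alpha> - ?d))"
    proof -
      \<comment> \<open>Outside the ball of radius \<open>norm a + 1\<close>, \<open>x\<close>
        differs from \<open>a\<close> and \<open>norm (x - a) \<le> 2 * norm x\<close>; this is the
        source of the factor \<open>2 powr ?d\<close>.\<close>
      have "bounded (\<Omega> \<union> cball 0 (norm a + 1))" using dom by simp
      then obtain B where "\<And>x. x \<in> \<Omega> \<union> cball 0 (norm a + 1) \<Longrightarrow> norm x \<le> B"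
        unfolding bounded_iff by blast
      then have "\<forall>\<^sub>F x in at_infinity. x \<notin> \<Omega> \<union> cball 0 (norm a + 1)"
        unfolding eventually_at_infinity by (intro exI[of _ "B + 1"]) fastforce
      with decay show ?thesis
      proof eventually_elim
        case (elim x)
        then have x: "norm x > norm a + 1" "x \<in> - \<Omega>" by auto
        then have nx: "norm x > 0" using norm_ge_zero[of a] by linarith
        have xa: "norm (x - a) > 0" using x by auto
        have "norm (x - a) \<le> 2 * norm x" using norm_triangle_ineq4[of x a] x by simp
        then have "(2 * norm x) powr (- ?d) \<le> norm (x - a) powr (- ?d)"
          using xa by (intro powr_mono2') auto
        also have "\<dots> = barrier a x"
        proof -
          have "(norm (x - a))\<^sup>2 = norm (x - a) powr 2" using xa by simp
          then show ?thesis by (simp only: powr_powr) simp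
        qed
        finally have "e * (2 * norm x) powr (- ?d) \<le> \<bar>f x\<bar>"
          using below[OF x(2)] mult_left_mono[of _ _ e] e by (smt (verit))
        then have "norm x powr \<alpha> * (e * (2 * norm x) powr (- ?d)) \<le> M"
          using elim(1) mult_left_mono[OF _ powr_ge_zero[of "norm x" \<alpha>]] by (smt (verit))
        then show ?case
          using e nx by (simp add: powr_minus powr_diff powr_mult field_simps)
      qed
    qed
    moreover have "((\<lambda>x::'a. norm x powr (- (\<alpha> - ?d))) \<longlongrightarrow> 0) at_infinity"
      using exponent by (intro tendsto_neg_powr filterlim_norm_at_top) auto
    then have "((\<lambda>x::'a. M * 2 powr ?d * norm x powr (- (\<alpha> - ?d))) \<longlongrightarrow> 0) at_infinity"
      by (rule tendsto_mult_right_zero)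
    then have "\<forall>\<^sub>F x::'a in at_infinity. M * 2 powr ?d * norm x powr (- (\<alpha> - ?d)) < e"
      using e by (rule order_tendstoD)
    ultimately have "\<forall>\<^sub>F x::'a in at_infinity. False"
      by eventually_elim simp
    then show False by (simp add: eventually_False trivial_limit_at_infinity)
  qed
  show "f x \<le> m" if "x \<in> - \<Omega>" for x
  \<comment> \<open>A barrier multiple that costs at most \<open>\<delta>\<close> on the frontier.
    The first claim makes the bound \<open>m + \<delta>\<close> admissible for the comparison, and
    the barrier term is then dropped.\<close>
  proof (rule field_le_epsilon)
    fix \<delta> :: real assume "\<delta> > 0"
    define e where "e = \<delta> / C"
    have e: "e > 0" using \<open>\<delta> > 0\<close> C by (simp add: e_def)
    have "f x + e * barrier a x \<le> m + \<delta>" if "x \<in> frontier \<Omega>" for x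
    proof -
      have "e * barrier a x \<le> e * C" using far[OF that] e by (intro mult_left_mono) auto
      also have "\<dots> = \<delta>" using C by (simp add: e_def)
      finally show ?thesis using bd[OF that] by simp
    qed
    then have "f x + e * barrier a x \<le> m + \<delta>"
      using m \<open>\<delta> > 0\<close> by (intro barrier_comparison[OF a e _ _ that]) auto
    moreover have "e * barrier a x \<ge> 0" using e by simp
    ultimately show "f x \<le> m + \<delta>" by linarith
  qed
qed

end

section \<open>First-order behaviour along rays and the outer normal\<close>

lemma C2_on_open_grad:
  assumes "C2_on U \<rho>" "open U" "x \<in> U"
  shows "(\<rho> has_derivative (\<lambda>h. grad \<rho> x \<bullet> h)) (at x)"
proof -
  obtain g where g: "(\<rho> has_derivative (\<lambda>h. g \<bullet> h)) (at x)"
    using assms unfolding C2_on_def by (metis at_within_open)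
  then have "frechet_derivative \<rho> (at x) = (\<lambda>h. g \<bullet> h)"
    by (rule frechet_derivative_at[symmetric])
  then have "grad \<rho> x = g" by (simp add: grad_def euclidean_representation)
  with g show ?thesis by simp
qed

text \<open>For boundary points, where the derivative is known only relative to the closed exterior:
  a ray that starts inside \<open>S\<close> suffices to read off the sign of the increment.\<close>

lemma has_derivative_pos_right:
  fixes f :: "'a::euclidean_space \<Rightarrow> real"
  assumes f': "(f has_derivative L) (at p within S)" and L: "L h > 0"
    and ray: "\<forall>\<^sub>F t in at_right 0. p + t *\<^sub>R h \<in> S"
  shows "\<forall>\<^sub>F t in at_right 0. f (p + t *\<^sub>R h) > f p"
proof -
  have lin: "bounded_linear L" using f' by (rule has_derivative_bounded_linear)
  have "h \<noteq> 0" using L linear_0[OF bounded_linear.linear[OF lin]] by auto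
  obtain b where b: "b > 0" and ray': "\<And>t. 0 < t \<Longrightarrow> t < b \<Longrightarrow> p + t *\<^sub>R h \<in> S"
    using ray unfolding eventually_at_right_field by auto
  define T where "T = {0<..<b}"
  have "(\<lambda>t. p + t *\<^sub>R h) ` T \<subseteq> S"
    using ray' by (auto simp: T_def)
  with f' have f1: "(f has_derivative L) (at p within (\<lambda>t. p + t *\<^sub>R h) ` T)"
    by (rule has_derivative_subset)
  have line: "((\<lambda>t. p + t *\<^sub>R h) has_derivative (\<lambda>t. t *\<^sub>R h)) (at 0 within T)"
    by (auto intro!: derivative_eq_intros)
  have "((\<lambda>t. f (p + t *\<^sub>R h)) has_derivative (\<lambda>t. L (t *\<^sub>R h))) (at 0 within T)"
    using has_derivative_in_compose[OF line, of f L] f1 by simp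
  then have "((\<lambda>t. f (p + t *\<^sub>R h)) has_real_derivative L h) (at 0 within T)"
    unfolding has_field_derivative_def
    by (simp add: linear_cmul[OF bounded_linear.linear[OF lin]] mult_commute_abs)
  from has_real_derivative_pos_inc_right[OF this L]
  obtain d where d: "d > 0" "\<And>t. 0 < t \<Longrightarrow> t \<in> T \<Longrightarrow> t < d \<Longrightarrow> f p < f (p + t *\<^sub>R h)"
    by auto
  show ?thesis
    unfolding eventually_at_right_field
    using d b by (intro exI[of _ "min b d"]) (auto simp: T_def)
qed

lemma eventually_ray_in_open:
  fixes p h :: "'a::euclidean_space"
  assumes "open U" "p \<in> U"
  shows "\<forall>\<^sub>F t in at_right 0. p + t *\<^sub>R h \<in> U"
proof -
  have "((\<lambda>t. p + t *\<^sub>R h) \<longlongrightarrow> p + 0 *\<^sub>R h) (at_right 0)"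
    by (intro tendsto_intros)
  then show ?thesis using assms by (auto dest: topological_tendstoD)
qed

context
  fixes \<Omega> :: "'a::euclidean_space set" and p :: 'a and \<nu>
  assumes bdry: "C2_boundary \<Omega>" and op: "open \<Omega>" and p: "p \<in> frontier \<Omega>"
  defines "\<nu> \<equiv> outer_normal \<Omega> p"
begin

text \<open>Opens the choice in \<open>outer_normal\<close>. Here \<open>\<rho> p \<ge> 0\<close>
  since \<open>p\<close> is outside the open set, and \<open>\<rho> p > 0\<close> would keep a
  neighbourhood of \<open>p\<close> disjoint from \<open>\<Omega>\<close>.\<close>

lemma outer_normal_obtain:
  obtains \<rho> U where "local_defining_fun \<Omega> p U \<rho>" "\<nu> = grad \<rho> p /\<^sub>R norm (grad \<rho> p)"
    "(\<rho> has_derivative (\<lambda>h. grad \<rho> p \<bullet> h)) (at p)" "grad \<rho> p \<noteq> 0" "\<rho> p = 0"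
proof -
  define \<rho> where "\<rho> = (SOME \<rho>. \<exists>U. local_defining_fun \<Omega> p U \<rho>)"
  have "\<exists>\<rho> U. local_defining_fun \<Omega> p U \<rho>"
    using bdry p unfolding C2_boundary_def by blast
  then have "\<exists>U. local_defining_fun \<Omega> p U \<rho>"
    unfolding \<rho>_def by (rule someI_ex)
  then obtain U where U: "local_defining_fun \<Omega> p U \<rho>" by blast
  then have *: "open U" "p \<in> U" "C2_on U \<rho>" "\<Omega> \<inter> U = {x \<in> U. \<rho> x < 0}" "grad \<rho> p \<noteq> 0"
    unfolding local_defining_fun_def by auto
  have \<rho>': "(\<rho> has_derivative (\<lambda>h. grad \<rho> p \<bullet> h)) (at p)"
    using C2_on_open_grad * by blast
  have "p \<notin> \<Omega>" using p op by (auto simp: frontier_def interior_open)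
  have in_iff: "x \<in> \<Omega> \<longleftrightarrow> \<rho> x < 0" if "x \<in> U" for x
    using *(4) that by blast
  have "\<rho> p \<ge> 0" using in_iff[OF *(2)] \<open>p \<notin> \<Omega>\<close> by simp
  moreover have "\<not> \<rho> p > 0"
  proof
    assume "\<rho> p > 0"
    have "(\<rho> \<longlongrightarrow> \<rho> p) (at p)"
      using has_derivative_continuous[OF \<rho>'] by (simp add: continuous_at)
    then have "\<forall>\<^sub>F x in at p. \<rho> x > 0" using \<open>\<rho> p > 0\<close> by (rule order_tendstoD)
    moreover have "\<forall>\<^sub>F x in at p. x \<in> U" using *(1,2) by (rule eventually_at_in_open')
    ultimately have "\<forall>\<^sub>F x in at p. x \<notin> \<Omega>"
      by eventually_elim (simp add: in_iff)
    then have "\<not> p islimpt \<Omega>" by (simp add: islimpt_iff_eventually)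
    then show False using p \<open>p \<notin> \<Omega>\<close> by (auto simp: frontier_def closure_def)
  qed
  ultimately have "\<rho> p = 0" by simp
  then show ?thesis
    using that[OF U _ \<rho>' *(5)] by (simp add: \<nu>_def outer_normal_def \<rho>_def Let_def)
qed

lemma norm_outer_normal: "norm \<nu> = 1"
  by (rule outer_normal_obtain) simp

text \<open>\<open>\<rho>\<close> vanishes at \<open>p\<close> and grows along its gradient. The ray
  makes the normal derivative relative to \<open>- \<Omega>\<close> usable.\<close>

lemma outer_normal_ray_outside:
  "\<forall>\<^sub>F t in at_right 0. p + t *\<^sub>R \<nu> \<in> - \<Omega>"
proof -
  obtain \<rho> U where \<rho>: "local_defining_fun \<Omega> p U \<rho>" "\<nu> = grad \<rho> p /\<^sub>R norm (grad \<rho> p)"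
    "(\<rho> has_derivative (\<lambda>h. grad \<rho> p \<bullet> h)) (at p)" "grad \<rho> p \<noteq> 0" "\<rho> p = 0"
    by (rule outer_normal_obtain)
  then have U: "open U" "p \<in> U" "\<Omega> \<inter> U = {x \<in> U. \<rho> x < 0}"
    unfolding local_defining_fun_def by auto
  have in_iff: "x \<in> \<Omega> \<longleftrightarrow> \<rho> x < 0" if "x \<in> U" for x
    using U(3) that by blast
  have "grad \<rho> p \<bullet> \<nu> > 0" using \<rho>(2,4) by simp
  then have "\<forall>\<^sub>F t in at_right 0. \<rho> (p + t *\<^sub>R \<nu>) > \<rho> p"
    by (intro has_derivative_pos_right[OF \<rho>(3)]) auto
  with eventually_ray_in_open[OF U(1,2), of \<nu>] show ?thesis
    by eventually_elim (simp add: in_iff \<rho>(5))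
qed

lemma inward_ray_inside:
  assumes "\<nu> \<bullet> h < 0"
  shows "\<forall>\<^sub>F t in at_right 0. p + t *\<^sub>R h \<in> \<Omega>"
proof -
  obtain \<rho> U where \<rho>: "local_defining_fun \<Omega> p U \<rho>" "\<nu> = grad \<rho> p /\<^sub>R norm (grad \<rho> p)"
    "(\<rho> has_derivative (\<lambda>h. grad \<rho> p \<bullet> h)) (at p)" "grad \<rho> p \<noteq> 0" "\<rho> p = 0"
    by (rule outer_normal_obtain)
  then have U: "open U" "p \<in> U" "\<Omega> \<inter> U = {x \<in> U. \<rho> x < 0}"
    unfolding local_defining_fun_def by auto
  have in_iff: "x \<in> \<Omega> \<longleftrightarrow> \<rho> x < 0" if "x \<in> U" for x
    using U(3) that by blast
  have "grad \<rho> p = norm (grad \<rho> p) *\<^sub>R \<nu>" using \<rho>(2,4) by simp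
  then have "grad \<rho> p \<bullet> h = norm (grad \<rho> p) * (\<nu> \<bullet> h)" by (metis inner_scaleR_left)
  then have "- (grad \<rho> p \<bullet> h) > 0" using assms \<rho>(4) by (simp add: mult_pos_neg)
  then have "\<forall>\<^sub>F t in at_right 0. - \<rho> (p + t *\<^sub>R h) > - \<rho> p"
    by (intro has_derivative_pos_right[OF has_derivative_minus[OF \<rho>(3)]]) auto
  with eventually_ray_in_open[OF U(1,2), of h] show ?thesis
    by eventually_elim (simp add: in_iff \<rho>(5))
qed

text \<open>Every \<open>h\<close> with \<open>\<nu> \<bullet> h < 0\<close> points into
  \<open>\<Omega>\<close>, where the norm cannot exceed that of \<open>p\<close>, so
  \<open>p \<bullet> h \<le> 0\<close>. This inclusion of half-spaces forces \<open>p\<close> to be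
  a nonnegative multiple of \<open>\<nu>\<close>.\<close>

lemma outer_normal_farthest:
  assumes far: "\<And>x. x \<in> \<Omega> \<Longrightarrow> norm x \<le> norm p"
  shows "p \<bullet> \<nu> = norm p"
proof -
  have half: "p \<bullet> h \<le> 0" if h: "\<nu> \<bullet> h < 0" for h
  proof (rule ccontr)
    assume "\<not> p \<bullet> h \<le> 0"
    then have pos: "2 * (p \<bullet> h) > 0" by simp
    have "((\<lambda>x. x \<bullet> x) has_derivative (\<lambda>h. 2 * (p \<bullet> h))) (at p)"
      by (auto intro!: derivative_eq_intros simp: inner_commute)
    from has_derivative_pos_right[OF this pos]
    have "\<forall>\<^sub>F t in at_right 0. (p + t *\<^sub>R h) \<bullet> (p + t *\<^sub>R h) > p \<bullet> p" by simp
    with inward_ray_inside[OF h] have "\<forall>\<^sub>F t in at_right (0::real). False"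
    proof eventually_elim
      case (elim t)
      then show ?case using far[of "p + t *\<^sub>R h"] norm_le by (metis not_le)
    qed
    then show False by (simp add: trivial_limit_at_right_real)
  qed
  have "\<nu> \<bullet> \<nu> = 1" using norm_outer_normal by (simp add: norm_eq_1)
  \<comment> \<open>The tangential part of \<open>p\<close>. Testing with
    \<open>q - e *\<^sub>R \<nu>\<close> and letting \<open>e\<close> tend to 0 shows that it
    vanishes.\<close>
  define q where "q = p - (p \<bullet> \<nu>) *\<^sub>R \<nu>"
  have q\<nu>: "q \<bullet> \<nu> = 0" by (simp add: q_def inner_diff_left \<open>\<nu> \<bullet> \<nu> = 1\<close>)
  have pq: "p \<bullet> q = q \<bullet> q"
  proof -
    have "p = q + (p \<bullet> \<nu>) *\<^sub>R \<nu>" by (simp add: q_def)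
    then have "p \<bullet> q = q \<bullet> q + (p \<bullet> \<nu>) * (\<nu> \<bullet> q)"
      by (metis inner_add_left inner_scaleR_left)
    then show ?thesis using q\<nu> by (simp add: inner_commute)
  qed
  have "q \<bullet> q \<le> e * (p \<bullet> \<nu>)" if "e > 0" for e
    using half[of "q - e *\<^sub>R \<nu>"] that q\<nu> pq \<open>\<nu> \<bullet> \<nu> = 1\<close>
    by (simp add: inner_diff_right inner_commute)
  then have le: "\<forall>\<^sub>F e in at_right 0. q \<bullet> q \<le> e * (p \<bullet> \<nu>)"
    unfolding eventually_at_right_field by (intro exI[of _ 1]) auto
  have "((\<lambda>e. e * (p \<bullet> \<nu>)) \<longlongrightarrow> 0 * (p \<bullet> \<nu>)) (at_right 0)"
    by (intro tendsto_intros)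
  from tendsto_lowerbound[OF this le] have "q \<bullet> q \<le> 0"
    by (simp add: trivial_limit_at_right_real)
  then have "q = 0" by (metis inner_ge_zero inner_eq_zero_iff order_antisym)
  then have p_eq: "p = (p \<bullet> \<nu>) *\<^sub>R \<nu>" by (simp add: q_def)
  have "p \<bullet> \<nu> \<ge> 0" using half[of "- \<nu>"] \<open>\<nu> \<bullet> \<nu> = 1\<close> by simp
  then show ?thesis
    using arg_cong[OF p_eq, of norm] norm_outer_normal by simp
qed

end

section \<open>Recovering a bounded open set from its frontier\<close>

text \<open>From dimension 2 on, the complement of a ball is connected. Being unbounded, it leaves
  \<open>\<Omega>\<close>, so if it met \<open>\<Omega>\<close> it would cross the frontier.\<close>

lemma bounded_subset_cball_of_frontier:
  fixes \<Omega> :: "'a::euclidean_space set"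
  assumes "bounded \<Omega>" "frontier \<Omega> \<subseteq> cball 0 r" "DIM('a) \<ge> 2"
  shows "\<Omega> \<subseteq> cball 0 r"
proof (rule ccontr)
  let ?C = "- cball (0::'a) r"
  assume "\<not> \<Omega> \<subseteq> cball 0 r"
  then have "?C \<inter> \<Omega> \<noteq> {}" by auto
  moreover have "?C - \<Omega> \<noteq> {}"
  proof
    assume "?C - \<Omega> = {}"
    then have "UNIV \<subseteq> cball 0 r \<union> \<Omega>" by auto
    then have "bounded (UNIV :: 'a set)"
      using assms(1) bounded_cball bounded_Un bounded_subset by metis
    then show False by (simp add: not_bounded_UNIV)
  qed
  moreover have "connected ?C"
    using assms(3) by (intro connected_complement_bounded_convex) auto
  ultimately have "?C \<inter> frontier \<Omega> \<noteq> {}" by (intro connected_Int_frontier)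
  then show False using assms(2) by auto
qed

text \<open>The open ball is connected, meets \<open>\<Omega>\<close> and misses its frontier, so it
  cannot leave \<open>\<Omega>\<close>.\<close>

lemma eq_ball_of_frontier_subset_sphere:
  fixes \<Omega> :: "'a::euclidean_space set"
  assumes "open \<Omega>" "bounded \<Omega>" "\<Omega> \<noteq> {}" "frontier \<Omega> \<subseteq> sphere 0 r" "DIM('a) \<ge> 2"
  shows "\<Omega> = ball 0 r"
proof
  have "\<Omega> \<subseteq> cball 0 r"
    by (rule bounded_subset_cball_of_frontier) (use assms sphere_cball in blast)+
  then have "\<Omega> \<subseteq> interior (cball 0 r)" using assms(1) by (intro interior_maximal)
  then show sub: "\<Omega> \<subseteq> ball 0 r" by simp
  show "ball 0 r \<subseteq> \<Omega>"
  proof (rule ccontr)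
    assume "\<not> ball 0 r \<subseteq> \<Omega>"
    then have "ball 0 r - \<Omega> \<noteq> {}" by auto
    moreover have "ball 0 r \<inter> \<Omega> \<noteq> {}" using sub assms(3) by auto
    ultimately have "ball 0 r \<inter> frontier \<Omega> \<noteq> {}"
      by (intro connected_Int_frontier convex_connected convex_ball)
    then show False using assms(4) by auto
  qed
qed

section \<open>The Laplacian as a trace, and the rigidity theorem\<close>

lemma laplacian_eq_trace:
  fixes u :: "'a::euclidean_space \<Rightarrow> real"
  assumes S: "open S" "x \<in> S"
    and u': "\<And>y. y \<in> S \<Longrightarrow> (u has_derivative (\<lambda>h. g y \<bullet> h)) (at y)"
    and g': "(g has_derivative H) (at x)"
  shows "laplacian u x = (\<Sum>b\<in>Basis. H b \<bullet> b)"
  unfolding laplacian_def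
proof (intro sum.cong refl)
  fix b :: 'a
  have "((\<lambda>y. g y \<bullet> b) has_derivative (\<lambda>h. H h \<bullet> b)) (at x)"
    using g' by (rule has_derivative_inner_left)
  then have "((\<lambda>y. frechet_derivative u (at y) b) has_derivative (\<lambda>h. H h \<bullet> b)) (at x)"
  proof (rule has_derivative_transform_within_open[OF _ S])
    show "g y \<bullet> b = frechet_derivative u (at y) b" if "y \<in> S" for y
      using frechet_derivative_at[OF u'[OF that]] by metis
  qed
  then show "frechet_derivative (\<lambda>y. frechet_derivative u (at y) b) (at x) b = H b \<bullet> b"
    using frechet_derivative_at by metis
qed

theorem theorem1p16:
  fixes \<Omega> :: "'a::euclidean_space set"
    and u :: "'a \<Rightarrow> real"
    and c \<alpha> :: real
  assumes dim: "DIM('a) \<ge> 3"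
    and dom: "open \<Omega>" "connected \<Omega>" "bounded \<Omega>" "\<Omega> \<noteq> {}"
    and bdry: "C2_boundary \<Omega>"
    and alpha: "\<alpha> > real DIM('a)"
    and reg: "C2_on (- \<Omega>) u"
    and pde: "\<forall>x\<in>- closure \<Omega>. laplacian u x = real DIM('a)"
    and dirichlet: "\<forall>p\<in>frontier \<Omega>. u p = 0"
    and neumann: "\<forall>p\<in>frontier \<Omega>. frechet_derivative u (at p within - \<Omega>) (outer_normal \<Omega> p) = 1"
    and asym: "\<exists>M. eventually
                 (\<lambda>x. norm x powr \<alpha> * \<bar>u x - (norm x ^ 2 / 2 + c)\<bar> \<le> M) at_infinity"
  shows "\<Omega> = ball 0 1 \<and> (\<forall>x\<in>- \<Omega>. u x = norm x ^ 2 / 2 - 1 / 2)"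
proof -
  define w where "w x = u x - (norm x ^ 2 / 2 + c)" for x
  obtain M where M: "\<forall>\<^sub>F x in at_infinity. norm x powr \<alpha> * \<bar>w x\<bar> \<le> M"
    using asym unfolding w_def by auto
  obtain g H where g: "\<And>x. x \<in> - \<Omega> \<Longrightarrow> (u has_derivative (\<lambda>h. g x \<bullet> h)) (at x within - \<Omega>)"
    and H: "\<And>x. x \<in> - \<Omega> \<Longrightarrow> (g has_derivative H x) (at x within - \<Omega>)"
    using reg unfolding C2_on_def by blast
  have w_within: "(w has_derivative (\<lambda>h. L h - p \<bullet> h)) (at p within - \<Omega>)"
    if "(u has_derivative L) (at p within - \<Omega>)" for L p
    unfolding w_def power2_norm_eq_inner
    by (auto intro!: derivative_eq_intros that simp: inner_commute)
  have cont: "continuous_on (- \<Omega>) w"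
    unfolding continuous_on_eq_continuous_within
    using w_within[OF g] has_derivative_continuous by blast
  have at_ext: "x \<in> - \<Omega>" "at x within - \<Omega> = at x" if "x \<in> - closure \<Omega>" for x
  proof -
    show "x \<in> - \<Omega>" using that closure_subset by auto
    have "x \<in> interior (- \<Omega>)" using that by (simp add: interior_complement)
    then show "at x within - \<Omega> = at x" by (rule at_within_interior)
  qed
  have u': "(u has_derivative (\<lambda>h. g x \<bullet> h)) (at x)" if "x \<in> - closure \<Omega>" for x
    using g[of x] at_ext[OF that] by simp
  have w': "(w has_derivative (\<lambda>h. (g x - x) \<bullet> h)) (at x)" if "x \<in> - closure \<Omega>" for x
    using w_within[OF g, of x] at_ext[OF that] by (simp add: inner_diff_left)
  have g': "(g has_derivative H x) (at x)" if "x \<in> - closure \<Omega>" for x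
    using H[of x] at_ext[OF that] by simp
  have gx': "((\<lambda>x. g x - x) has_derivative (\<lambda>h. H x h - h)) (at x)" if "x \<in> - closure \<Omega>" for x
    by (intro has_derivative_diff g' that has_derivative_ident)
  \<comment> \<open>The quadratic part has the identity as Hessian, whose trace cancels the
    right-hand side of the equation.\<close>
  have harmonic: "(\<Sum>b\<in>Basis. (H x b - b) \<bullet> b) = 0" if "x \<in> - closure \<Omega>" for x
  proof -
    have "laplacian u x = (\<Sum>b\<in>Basis. H x b \<bullet> b)"
      using that by (intro laplacian_eq_trace[OF _ that u' g']) auto
    then show ?thesis using pde that by (simp add: inner_diff_left sum_subtractf)
  qed
  interpret pos: exterior_subharmonic \<Omega> w "\<lambda>x. g x - x" "\<lambda>x h. H x h - h" \<alpha> M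
    using dom cont w' gx' harmonic M alpha by unfold_locales auto
  interpret neg: exterior_subharmonic \<Omega> "\<lambda>x. - w x" "\<lambda>x. - (g x - x)" "\<lambda>x h. - (H x h - h)" \<alpha> M
  proof unfold_locales
    show "((\<lambda>x. - w x) has_derivative (\<lambda>h. - (g x - x) \<bullet> h)) (at x)" if "x \<in> - closure \<Omega>" for x
      using has_derivative_minus[OF w'[OF that]] by (simp only: inner_minus_left)
    show "((\<lambda>x. - (g x - x)) has_derivative (\<lambda>h. - (H x h - h))) (at x)" if "x \<in> - closure \<Omega>" for x
      using gx'[OF that] by (rule has_derivative_minus)
    show "(\<Sum>b\<in>Basis. - (H x b - b) \<bullet> b) \<ge> 0" if "x \<in> - closure \<Omega>" for x
      unfolding inner_minus_left sum_negf harmonic[OF that] by simp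
  qed (use dom cont M alpha in \<open>auto intro: continuous_intros\<close>)

  have w_bd: "w x = - (norm x ^ 2 / 2 + c)" if "x \<in> frontier \<Omega>" for x
    using dirichlet that by (simp add: w_def)
  define D where "D p h = frechet_derivative u (at p within - \<Omega>) h - p \<bullet> h" for p h
  have D: "(w has_derivative D p) (at p within - \<Omega>)" if "p \<in> frontier \<Omega>" for p
  proof -
    have "p \<in> - \<Omega>" using that dom(1) by (auto simp: frontier_def interior_open)
    then have "(u has_derivative frechet_derivative u (at p within - \<Omega>)) (at p within - \<Omega>)"
      using g frechet_derivative_works differentiable_def by blast
    then show ?thesis unfolding D_def by (rule w_within)
  qed
  have D_\<nu>: "D p (outer_normal \<Omega> p) = 1 - p \<bullet> outer_normal \<Omega> p" if "p \<in> frontier \<Omega>" for p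
    using neumann that by (simp add: D_def)

  have cpt: "compact (frontier \<Omega>)" using dom by (simp add: compact_frontier_bounded)
  have "\<Omega> \<noteq> UNIV" using dom not_bounded_UNIV by auto
  then have ne: "frontier \<Omega> \<noteq> {}" using dom by (simp add: frontier_eq_empty)
  have norm_cont: "continuous_on (frontier \<Omega>) norm" by (intro continuous_intros)
  obtain p where p: "p \<in> frontier \<Omega>" and pmax: "\<And>x. x \<in> frontier \<Omega> \<Longrightarrow> norm x \<le> norm p"
    using continuous_attains_sup[OF cpt ne norm_cont] by blast
  obtain q where q: "q \<in> frontier \<Omega>" and qmin: "\<And>x. x \<in> frontier \<Omega> \<Longrightarrow> norm q \<le> norm x"
    using continuous_attains_inf[OF cpt ne norm_cont] by blast
  \<comment> \<open>As \<open>u\<close> vanishes on the frontier, \<open>w\<close> decreases there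
    with the norm, so extremal norms give extremal values of \<open>w\<close>.\<close>
  have p_min: "- w x \<le> - w p" if "x \<in> frontier \<Omega>" for x
    using w_bd[OF that] w_bd[OF p] power_mono[OF pmax[OF that], of 2] by simp
  have w_min: "w p \<le> 0" "\<And>x. x \<in> - \<Omega> \<Longrightarrow> w p \<le> w x"
    using neg.maximum_principle[of "- w p"] p_min by auto
  have q_max: "w x \<le> w q" if "x \<in> frontier \<Omega>" for x
    using w_bd[OF that] w_bd[OF q] power_mono[OF qmin[OF that], of 2] by simp
  have w_max: "w q \<ge> 0" "\<And>x. x \<in> - \<Omega> \<Longrightarrow> w x \<le> w q"
    using pos.maximum_principle[of "w q"] q_max by auto

  have "norm p \<le> 1"
  proof -
    let ?\<nu> = "outer_normal \<Omega> p"
    note ray = outer_normal_ray_outside[OF bdry dom(1) p]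
    have "D p ?\<nu> \<ge> 0"
    proof (rule ccontr)
      assume "\<not> D p ?\<nu> \<ge> 0"
      then have "- D p ?\<nu> > 0" by simp
      from has_derivative_pos_right[OF has_derivative_minus[OF D[OF p]] this ray] ray
      have "\<forall>\<^sub>F t in at_right (0::real). False"
        by eventually_elim (metis w_min(2) neg_less_iff_less not_le)
      then show False by (simp add: trivial_limit_at_right_real)
    qed
    then have "p \<bullet> ?\<nu> \<le> 1" using D_\<nu>[OF p] by simp
    \<comment> \<open>\<open>p\<close> is farthest only among frontier points so far;
      \<open>outer_normal_farthest\<close> needs this for all of \<open>\<Omega>\<close>.\<close>
    moreover have "\<Omega> \<subseteq> cball 0 (norm p)"
    proof (rule bounded_subset_cball_of_frontier[OF dom(3)])
      show "frontier \<Omega> \<subseteq> cball 0 (norm p)" using pmax by (intro subsetI) simp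
    qed (use dim in simp)
    then have "p \<bullet> ?\<nu> = norm p"
      by (intro outer_normal_farthest[OF bdry dom(1) p]) (auto simp: subset_iff)
    ultimately show ?thesis by simp
  qed
  moreover have "norm q \<ge> 1"
  proof -
    let ?\<nu> = "outer_normal \<Omega> q"
    note ray = outer_normal_ray_outside[OF bdry dom(1) q]
    have "D q ?\<nu> \<le> 0"
    proof (rule ccontr)
      assume "\<not> D q ?\<nu> \<le> 0"
      then have "D q ?\<nu> > 0" by simp
      from has_derivative_pos_right[OF D[OF q] this ray] ray
      have "\<forall>\<^sub>F t in at_right (0::real). False"
        by eventually_elim (metis w_max(2) not_le)
      then show False by (simp add: trivial_limit_at_right_real)
    qed
    then have "1 \<le> q \<bullet> ?\<nu>" using D_\<nu>[OF q] by simp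
    also have "\<dots> \<le> norm q * norm ?\<nu>" by (rule norm_cauchy_schwarz)
    also have "\<dots> = norm q" by (simp add: norm_outer_normal[OF bdry dom(1) q])
    finally show ?thesis .
  qed
  ultimately have sphere: "norm x = 1" if "x \<in> frontier \<Omega>" for x
    using pmax[OF that] qmin[OF that] by simp
  have "\<Omega> = ball 0 1"
    using dom dim sphere by (intro eq_ball_of_frontier_subset_sphere) auto
  moreover have "u x = norm x ^ 2 / 2 - 1 / 2" if "x \<in> - \<Omega>" for x
  proof -
    have "w p = - 1 / 2 - c" "w q = - 1 / 2 - c"
      using w_bd[OF p] w_bd[OF q] sphere[OF p] sphere[OF q] by auto
    \<comment> \<open>\<open>w p\<close> and \<open>w q\<close> are equal with
      \<open>w p \<le> 0 \<le> w q\<close>, so both are 0, which fixes \<open>c\<close> and squeezes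
      \<open>w\<close> to 0 on the exterior.\<close>
    then have "c = - 1 / 2" "w x = 0"
      using w_min(1) w_max(1) w_min(2)[OF that] w_max(2)[OF that] by auto
    then show ?thesis by (simp add: w_def)
  qed
  ultimately show ?thesis by blast
qed

end
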